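(* A sequence $(f_n)_{n\in\mathbb{N}}$ of boolean functions has CNF-representations $(F_n)_{n\in\mathbb{N}}$ with $\mathrm{hd}^{\mathrm{var}(f_n)}(F_n)\le1$ and $\ell(F_n)=n^{O(1)}$ if and only if the sequence $(\widehat{f_n})_{n\in\mathbb{N}}$ can be computed by monotone circuits of size polynomial in $n$.
   Context: Clauses are finite sets of literals without complementary pairs ($\bot$ empty clause), clause-sets finite sets of clauses (CNF), $\ell(F)=\sum_{C\in F}|C|$; $\varphi*F$ applies a partial assignment (delete satisfied clauses and falsified literals). $r_1$ is unit-clause propagation ($r_1(F)=\{\bot\}$ if $\bot\in F$; else propagate unit clauses $\{x\}$ via $\langle x\to1\rangle$ until none remains). A boolean function $f$ maps total assignments of a finite variable set $\mathrm{var}(f)$ to $\{0,1\}$. A CNF-representation of $f$ is a clause-set $F$ with $\mathrm{var}(f)\subseteq\mathrm{var}(F)$ such that for every total assignment $\varphi$ of $\mathrm{var}(f)$, $\varphi*F$ is satisfiable iff $f(\varphi)=1$. $\mathrm{hd}^V(F)\le 1$ means: for every partial assignment $\varphi$ with $\mathrm{var}(\varphi)\subseteq V$ and $\varphi*F$ unsatisfiable, $r_1(\varphi*F)=\{\bot\}$. The monotonisation $\widehat{f}$ of $f$ with $\mathrm{var}(f)=\{v_1,\dots,v_n\}$ has inputs $v_i^0,v_i^1$ and equals $1$ iff there is a total assignment $\psi$ with $f(\psi)=1$ and $v_i^{1-\psi(v_i)}=1$ for all $i$ (so $v_i^0=v_i^1=1$ encodes "$v_i$ unassigned", $v_i^0=1,v_i^1=0$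 encodes $v_i=1$, $v_i^0=0,v_i^1=1$ encodes $v_i=0$). Monotone circuits use AND and OR gates; size is the number of nodes plus edges plus inputs. *)

theory Defs
  imports Complex_Main "HOL-Library.Landau_Symbols" "HOL-Library.Infinite_Typeclass"
begin

datatype 'v lit = Pos (lvar: 'v) | Neg (lvar: 'v)

primrec lsign :: "'v lit \<Rightarrow> bool" where
  "lsign (Pos v) = True"
| "lsign (Neg v) = False"

primrec compl :: "'v lit \<Rightarrow> 'v lit" where
  "compl (Pos v) = Neg v"
| "compl (Neg v) = Pos v"

type_synonym 'v clause = "'v lit set"

definition is_clause :: "'v clause \<Rightarrow> bool" where
  "is_clause C \<longleftrightarrow> finite C \<and> (\<forall>x\<in>C. compl x \<notin> C)"

definition is_clause_set :: "'v clause set \<Rightarrow> bool" where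
  "is_clause_set F \<longleftrightarrow> finite F \<and> (\<forall>C\<in>F. is_clause C)"

definition vars :: "'v clause set \<Rightarrow> 'v set" where
  "vars F = lvar ` \<Union>F"

definition ell :: "'v clause set \<Rightarrow> nat" where
  "ell F = (\<Sum>C\<in>F. card C)"

type_synonym 'v passign = "'v \<rightharpoonup> bool"

definition satisfies_lit :: "'v passign \<Rightarrow> 'v lit \<Rightarrow> bool" where
  "satisfies_lit \<phi> x \<longleftrightarrow> \<phi> (lvar x) = Some (lsign x)"

definition falsifies_lit :: "'v passign \<Rightarrow> 'v lit \<Rightarrow> bool" where
  "falsifies_lit \<phi> x \<longleftrightarrow> \<phi> (lvar x) = Some (\<not> lsign x)"

definition apply_pa :: "'v passign \<Rightarrow> 'v clause set \<Rightarrow> 'v clause set" where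
  "apply_pa \<phi> F =
     (\<lambda>C. {x \<in> C. \<not> falsifies_lit \<phi> x}) ` {C \<in> F. \<forall>x\<in>C. \<not> satisfies_lit \<phi> x}"

definition satisfiable :: "'v clause set \<Rightarrow> bool" where
  "satisfiable F \<longleftrightarrow> (\<exists>\<phi>. finite (dom \<phi>) \<and> apply_pa \<phi> F = {})"

definition assign_lit :: "'v lit \<Rightarrow> 'v passign" where
  "assign_lit x = [lvar x \<mapsto> lsign x]"

text \<open>The recursion terminates on every clause-set, since each step removes a variable; the
  lemma \<open>r1_unit\<close> below shows that the result does not depend on which unit-clause is picked.\<close>

partial_function (tailrec) r1 :: "'v clause set \<Rightarrow> 'v clause set" where
  "r1 F = (if {} \<in> F then {{}}
           else if \<exists>x. {x} \<in> F then r1 (apply_pa (assign_lit (SOME x. {x} \<in> F)) F)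
           else F)"

definition hd_le_1 :: "'v set \<Rightarrow> 'v clause set \<Rightarrow> bool" where
  "hd_le_1 V F \<longleftrightarrow>
     (\<forall>\<phi>. finite (dom \<phi>) \<and> dom \<phi> \<subseteq> V \<and> \<not> satisfiable (apply_pa \<phi> F)
        \<longrightarrow> r1 (apply_pa \<phi> F) = {{}})"

text \<open>Only the values of \<open>bf_val\<close> at total assignments of \<open>bf_vars\<close>, that is, at maps with domain
  exactly \<open>bf_vars\<close>, are meaningful. Finiteness of \<open>bf_vars\<close> is a separate hypothesis.\<close>

datatype 'v boolfun = BoolFun (bf_vars: "'v set") (bf_val: "'v passign \<Rightarrow> bool")

definition is_boolfun :: "'v boolfun \<Rightarrow> bool" where
  "is_boolfun f \<longleftrightarrow> finite (bf_vars f)"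

definition cnf_representation :: "'v clause set \<Rightarrow> 'v boolfun \<Rightarrow> bool" where
  "cnf_representation F f \<longleftrightarrow> is_clause_set F \<and> bf_vars f \<subseteq> vars F \<and>
     (\<forall>\<phi>. dom \<phi> = bf_vars f \<longrightarrow> (satisfiable (apply_pa \<phi> F) \<longleftrightarrow> bf_val f \<phi>))"

text \<open>The input \<open>v\<^sup>b\<close> of the monotonisation is the pair \<open>(v, b)\<close>, with \<open>False\<close> for \<open>0\<close> and
  \<open>True\<close> for \<open>1\<close>.\<close>

definition monotonisation :: "'v boolfun \<Rightarrow> ('v \<times> bool) boolfun" where
  "monotonisation f = BoolFun (bf_vars f \<times> UNIV)
     (\<lambda>\<alpha>. \<exists>\<psi>. dom \<psi> = bf_vars f \<and> bf_val f \<psi> \<and>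
        (\<forall>v\<in>bf_vars f. \<alpha> (v, \<not> the (\<psi> v)) = Some True))"

text \<open>A circuit is a directed acyclic graph whose gates are listed in topological order, so that
  gate \<open>k\<close> may only read inputs and gates with index below \<open>k\<close>. Fan-in is unbounded, and the gates
  \<open>And {}\<close> and \<open>Or {}\<close> are the constants \<open>1\<close> and \<open>0\<close>.\<close>

datatype 'i node = Input 'i | Gate nat

datatype 'i gate = And (preds: "'i node set") | Or (preds: "'i node set")

datatype 'i mcircuit =
  MCircuit (inputs: "'i set") (gates: "'i gate list") (out_node: "'i node")

definition is_mcircuit :: "'i mcircuit \<Rightarrow> bool" where
  "is_mcircuit C \<longleftrightarrow> finite (inputs C) \<and>
     (\<forall>k < length (gates C). preds (gates C ! k) \<subseteq> Input ` inputs C \<union> Gate ` {..<k}) \<and>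
     out_node C \<in> Input ` inputs C \<union> Gate ` {..<length (gates C)}"

primrec node_val :: "'i passign \<Rightarrow> bool list \<Rightarrow> 'i node \<Rightarrow> bool" where
  "node_val \<alpha> bs (Input i) = (\<alpha> i = Some True)"
| "node_val \<alpha> bs (Gate k) = bs ! k"

primrec gate_val :: "'i passign \<Rightarrow> bool list \<Rightarrow> 'i gate \<Rightarrow> bool" where
  "gate_val \<alpha> bs (And P) = (\<forall>p\<in>P. node_val \<alpha> bs p)"
| "gate_val \<alpha> bs (Or P) = (\<exists>p\<in>P. node_val \<alpha> bs p)"

definition gate_vals :: "'i passign \<Rightarrow> 'i gate list \<Rightarrow> bool list" where
  "gate_vals \<alpha> gs = foldl (\<lambda>bs g. bs @ [gate_val \<alpha> bs g]) [] gs"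

definition circuit_val :: "'i mcircuit \<Rightarrow> 'i passign \<Rightarrow> bool" where
  "circuit_val C \<alpha> = node_val \<alpha> (gate_vals \<alpha> (gates C)) (out_node C)"

definition computes :: "'i mcircuit \<Rightarrow> 'i boolfun \<Rightarrow> bool" where
  "computes C f \<longleftrightarrow> is_mcircuit C \<and> inputs C = bf_vars f \<and>
     (\<forall>\<alpha>. dom \<alpha> = bf_vars f \<longrightarrow> (circuit_val C \<alpha> \<longleftrightarrow> bf_val f \<alpha>))"

definition circuit_size :: "'i mcircuit \<Rightarrow> nat" where
  "circuit_size C =
     length (gates C) + (\<Sum>g\<leftarrow>gates C. card (preds g)) + card (inputs C)"

definition poly_bounded :: "(nat \<Rightarrow> nat) \<Rightarrow> bool" where
  "poly_bounded s \<longleftrightarrow> (\<exists>k::nat. (\<lambda>n. real (s n)) \<in> O(\<lambda>n. real n ^ k))"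

lemma lit_eq_iff: "x = y \<longleftrightarrow> lvar x = lvar y \<and> lsign x = lsign y"
  by (cases x; cases y) auto

lemma lvar_compl [simp]: "lvar (compl x) = lvar x" and lsign_compl [simp]: "lsign (compl x) = (\<not> lsign x)"
  by (cases x; simp)+

lemma apply_assign_lit:
  "apply_pa (assign_lit x) F = (\<lambda>C. C - {compl x}) ` {C \<in> F. x \<notin> C}"
proof -
  have "satisfies_lit (assign_lit x) y \<longleftrightarrow> y = x" "falsifies_lit (assign_lit x) y \<longleftrightarrow> y = compl x" for y
    by (auto simp: satisfies_lit_def falsifies_lit_def assign_lit_def lit_eq_iff)
  then show ?thesis
    by (auto simp: apply_pa_def set_diff_eq image_def)
qed

lemma apply_assign_lit_commute:
  assumes "y \<noteq> compl x"
  shows "apply_pa (assign_lit x) (apply_pa (assign_lit y) F) = apply_pa (assign_lit y) (apply_pa (assign_lit x) F)"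
proof -
  have twice: "apply_pa (assign_lit u) (apply_pa (assign_lit w) F) =
      (\<lambda>C. C - {compl w} - {compl u}) ` {C \<in> F. w \<notin> C \<and> u \<notin> C}" if "u \<noteq> compl w" for u w
  proof -
    have "{D \<in> (\<lambda>C. C - {compl w}) ` {C \<in> F. w \<notin> C}. u \<notin> D} =
        (\<lambda>C. C - {compl w}) ` {C \<in> F. w \<notin> C \<and> u \<notin> C}"
      using that by auto
    then show ?thesis
      by (simp only: apply_assign_lit image_image)
  qed
  have "x \<noteq> compl y"
    using assms by (auto simp: lit_eq_iff)
  with assms show ?thesis
    by (simp add: twice Diff_insert [symmetric] Diff_insert2 [symmetric] insert_commute conj_commute)
qed

lemma vars_apply_assign_lit: "vars (apply_pa (assign_lit x) F) \<subseteq> vars F - {lvar x}"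
proof
  fix v assume "v \<in> vars (apply_pa (assign_lit x) F)"
  then obtain C y where *: "C \<in> F" "x \<notin> C" "y \<in> C" "y \<noteq> compl x" "v = lvar y"
    by (auto simp: vars_def apply_assign_lit)
  then have "lvar y \<noteq> lvar x"
    using lit_eq_iff [of y x] lit_eq_iff [of y "compl x"] by auto
  with * show "v \<in> vars F - {lvar x}"
    by (auto simp: vars_def)
qed

lemma r1_bot: "{} \<in> F \<Longrightarrow> r1 F = {{}}"
  by (subst r1.simps) simp

lemma r1_unit:
  assumes "finite (vars F)" "{} \<notin> F" "{x} \<in> F"
  shows "r1 F = r1 (apply_pa (assign_lit x) F)"
  using assms
proof (induction "card (vars F)" arbitrary: F x rule: less_induct)
  case less
  define y where "y = (SOME y. {y} \<in> F)"
  have y: "{y} \<in> F"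
    unfolding y_def using less.prems(3) by (rule someI)
  have step: "r1 F = r1 (apply_pa (assign_lit y) F)"
    using less.prems by (subst r1.simps) (auto simp: y_def)
  have smaller: "card (vars (apply_pa (assign_lit z) F)) < card (vars F)"
      "finite (vars (apply_pa (assign_lit z) F))" if "{z} \<in> F" for z
  proof -
    have "lvar z \<in> vars F"
      using that by (force simp: vars_def)
    then have "vars (apply_pa (assign_lit z) F) \<subset> vars F"
      using vars_apply_assign_lit [of z F] by blast
    then show "card (vars (apply_pa (assign_lit z) F)) < card (vars F)"
      "finite (vars (apply_pa (assign_lit z) F))"
      using less.prems(1) by (auto intro: psubset_card_mono finite_subset)
  qed
  have bot: "{} \<in> apply_pa (assign_lit z) F \<longleftrightarrow> {compl z} \<in> F" for z
    using less.prems(2) lit_eq_iff [of z "compl z"]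
    by (auto simp: apply_assign_lit image_iff subset_singleton_iff)
  have next_step: "r1 (apply_pa (assign_lit z) F) =
      r1 (apply_pa (assign_lit w) (apply_pa (assign_lit z) F))"
    if "{z} \<in> F" "{w} \<in> F" "w \<noteq> z" "w \<noteq> compl z" for z w
  proof (cases "{compl z} \<in> F")
    case True
    then have "{} \<in> apply_pa (assign_lit z) F"
      by (simp add: bot)
    moreover from this have "{} \<in> apply_pa (assign_lit w) (apply_pa (assign_lit z) F)"
      by (subst apply_assign_lit) force
    ultimately show ?thesis
      by (simp add: r1_bot)
  next
    case False
    have "{w} \<in> apply_pa (assign_lit z) F"
      using that by (auto simp: apply_assign_lit image_iff intro!: bexI [of _ "{w}"])
    with False show ?thesis
      using less.hyps [OF smaller [OF that(1)]] bot by blast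
  qed
  consider "x = y" | "x = compl y" | "x \<noteq> y" "x \<noteq> compl y"
    by blast
  then show ?case
  proof cases
    case 2
    then have "compl x = y"
      by (simp add: lit_eq_iff)
    with 2 y less.prems(3) have "{} \<in> apply_pa (assign_lit x) F" "{} \<in> apply_pa (assign_lit y) F"
      by (auto simp: bot)
    with step show ?thesis
      by (simp add: r1_bot)
  next
    case 3
    then have "y \<noteq> compl x"
      by (auto simp: lit_eq_iff)
    with 3 show ?thesis
      using step next_step [OF y less.prems(3)] next_step [OF less.prems(3) y]
        apply_assign_lit_commute [of y x F] by simp
  qed (use step in simp)
qed

lemma r1_no_unit: "{} \<notin> F \<Longrightarrow> \<nexists>x. {x} \<in> F \<Longrightarrow> r1 F = F"
  by (subst r1.simps) simp

end

theory Submission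
  imports Defs
begin

text \<open>Unit propagation is monotone in the set of literals falsified so far, and falsifying more
  literals means setting more inputs \<open>v\<^sup>0\<close>, \<open>v\<^sup>1\<close> of the monotonisation to \<open>0\<close>. So polynomially
  many rounds of unit propagation are a monotone circuit for "no conflict", and \<open>hd \<le> 1\<close> says that
  this circuit decides satisfiability of \<open>\<phi> * F\<close>. Conversely, unit propagation on the one-sided
  Tseitin translation of a monotone circuit pushes the value \<open>0\<close> from the inputs to the output,
  where it refutes the unit clause asserting the output.\<close>

section \<open>Satisfiability and unit propagation\<close>

text \<open>The two directions meet in one characterisation: \<open>r1\<close> derives the empty
  clause from \<open>\<phi> * F\<close> iff every set of literals that contains those falsified by
  \<open>\<phi>\<close> and is closed under propagation in \<open>F\<close> includes a clause of
  \<open>F\<close>. It replaces the changing clause-sets of \<open>r1\<close> by closed sets over a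
  fixed \<open>F\<close>. Such sets arise in three ways: as the limit of the rounds, as the literals
  false under a model, and as what a propagation without conflict leaves behind. The obstacle on the
  way to circuits is that an input of the monotonisation need not encode a partial assignment. If
  \<open>v\<^sup>0 = v\<^sup>1 = 0\<close>, the function is 0, while \<open>F\<close> may show no
  conflict. So closed sets may contain complementary literals, and the output gate also tests every
  pair \<open>{v, \<not> v}\<close>. The circuit is cubic in \<open>ell F + 1\<close>: at most
  \<open>2 * ell F\<close> rounds of quadratic size each. The converse translation is
  linear.\<close>

definition models :: "('v \<Rightarrow> bool) \<Rightarrow> 'v clause set \<Rightarrow> bool" where
  "models \<tau> F \<longleftrightarrow> (\<forall>C\<in>F. \<exists>x\<in>C. \<tau> (lvar x) = lsign x)"

definition extends :: "('v \<Rightarrow> bool) \<Rightarrow> 'v passign \<Rightarrow> bool" where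
  "extends \<tau> \<phi> \<longleftrightarrow> (\<forall>v b. \<phi> v = Some b \<longrightarrow> \<tau> v = b)"

lemma compl_compl [simp]: "compl (compl x) = x"
  by (simp add: lit_eq_iff)

lemma compl_neq [simp]: "compl x \<noteq> x" "x \<noteq> compl x"
  by (auto simp: lit_eq_iff)

lemma finite_vars: "is_clause_set F \<Longrightarrow> finite (vars F)"
  by (auto simp: is_clause_set_def is_clause_def vars_def)

lemma apply_pa_empty_iff: "apply_pa \<phi> F = {} \<longleftrightarrow> (\<forall>C\<in>F. \<exists>x\<in>C. satisfies_lit \<phi> x)"
  by (auto simp: apply_pa_def)

lemma ell_Un_le: "finite F \<Longrightarrow> finite G \<Longrightarrow> ell (F \<union> G) \<le> ell F + ell G"
  by (simp add: ell_def sum_Un_nat)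

lemma ell_UN_le:
  assumes "finite K" "\<And>k. k \<in> K \<Longrightarrow> finite (G k)"
  shows "ell (\<Union>k\<in>K. G k) \<le> (\<Sum>k\<in>K. ell (G k))"
  using assms
proof (induction K rule: finite_induct)
  case (insert k K)
  then have "ell (G k \<union> (\<Union>k\<in>K. G k)) \<le> ell (G k) + ell (\<Union>k\<in>K. G k)"
    by (intro ell_Un_le) auto
  with insert show ?case by fastforce
qed (simp add: ell_def)

text \<open>Total functions avoid all bookkeeping of domains. A literal that satisfies a shortened
  clause has a variable undefined in \<open>\<phi>\<close>, so overriding the satisfying assignment
  by \<open>\<phi>\<close> does no harm; conversely, restricting \<open>\<tau>\<close> to
  \<open>vars F\<close> gives the finite domain.\<close>

lemma satisfiable_apply_pa_iff:
  assumes "finite (vars F)"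
  shows "satisfiable (apply_pa \<phi> F) \<longleftrightarrow> (\<exists>\<tau>. extends \<tau> \<phi> \<and> models \<tau> F)"
proof
  assume "satisfiable (apply_pa \<phi> F)"
  then obtain \<sigma> where \<sigma>: "\<And>C. C \<in> apply_pa \<phi> F \<Longrightarrow> \<exists>x\<in>C. satisfies_lit \<sigma> x"
    by (auto simp: satisfiable_def apply_pa_empty_iff)
  define \<tau> where "\<tau> v = (case \<phi> v of Some b \<Rightarrow> b | None \<Rightarrow> \<sigma> v = Some True)" for v
  have "\<exists>x\<in>C. \<tau> (lvar x) = lsign x" if "C \<in> F" for C
  proof (cases "\<exists>x\<in>C. satisfies_lit \<phi> x")
    case True
    then show ?thesis by (auto simp: satisfies_lit_def \<tau>_def intro!: bexI)
  next
    case False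
    with that have "{x \<in> C. \<not> falsifies_lit \<phi> x} \<in> apply_pa \<phi> F"
      by (auto simp: apply_pa_def)
    from \<sigma> [OF this] obtain x where x: "x \<in> C" "\<not> falsifies_lit \<phi> x" "satisfies_lit \<sigma> x"
      by auto
    with False have "\<phi> (lvar x) = None"
      by (cases "\<phi> (lvar x)") (auto simp: falsifies_lit_def satisfies_lit_def)
    with x show ?thesis
      by (auto simp: satisfies_lit_def \<tau>_def intro!: bexI [of _ x])
  qed
  then show "\<exists>\<tau>. extends \<tau> \<phi> \<and> models \<tau> F"
    by (intro exI [of _ \<tau>]) (auto simp: extends_def models_def \<tau>_def)
next
  assume "\<exists>\<tau>. extends \<tau> \<phi> \<and> models \<tau> F"
  then obtain \<tau> where \<tau>: "extends \<tau> \<phi>" "models \<tau> F" by blast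
  define \<sigma> where "\<sigma> v = (if v \<in> vars F then Some (\<tau> v) else None)" for v
  have "finite (dom \<sigma>)"
    using assms by (auto simp: \<sigma>_def dom_def)
  moreover have "\<exists>x\<in>D. satisfies_lit \<sigma> x" if D: "D \<in> apply_pa \<phi> F" for D
  proof -
    obtain C where C: "C \<in> F" "D = {x \<in> C. \<not> falsifies_lit \<phi> x}"
      using D by (auto simp: apply_pa_def)
    obtain x where x: "x \<in> C" "\<tau> (lvar x) = lsign x"
      using \<tau>(2) C by (auto simp: models_def)
    then have "x \<in> D"
      using \<tau>(1) C by (auto simp: extends_def falsifies_lit_def)
    moreover have "lvar x \<in> vars F"
      using x C by (auto simp: vars_def)
    ultimately show ?thesis
      using x by (auto simp: satisfies_lit_def \<sigma>_def)
  qed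
  ultimately show "satisfiable (apply_pa \<phi> F)"
    unfolding satisfiable_def apply_pa_empty_iff by blast
qed

section \<open>Unit propagation as closure of a set of falsified literals\<close>

text \<open>\<open>D\<close> is read as a set of falsified literals.\<close>

definition up_closed :: "'v clause set \<Rightarrow> 'v lit set \<Rightarrow> bool" where
  "up_closed F D \<longleftrightarrow> (\<forall>C\<in>F. \<forall>y\<in>C. C - {y} \<subseteq> D \<longrightarrow> compl y \<in> D)"

text \<open>The last premise is an invariant of propagation. For a unit clause \<open>{x}\<close>
  there is \<open>C\<close> with \<open>C - D \<subseteq> {x}\<close>: either
  \<open>C \<subseteq> D\<close>, or \<open>x\<close> is the only literal of \<open>C\<close>
  outside \<open>D\<close>. In the second case closure gives \<open>compl x \<in> D\<close>, so
  deleting \<open>compl x\<close> from the clauses of \<open>G\<close> preserves the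
  invariant.\<close>

lemma conflict_if_r1_bot:
  assumes "up_closed F D" "finite (vars G)" "r1 G = {{}}" "\<And>B. B \<in> G \<Longrightarrow> \<exists>C\<in>F. C - D \<subseteq> B"
  shows "\<exists>C\<in>F. C \<subseteq> D"
  using assms(2-)
proof (induction "card (vars G)" arbitrary: G rule: less_induct)
  case less
  consider "{} \<in> G" | x where "{} \<notin> G" "{x} \<in> G" | "{} \<notin> G" "\<nexists>x. {x} \<in> G" by blast
  then show ?case
  proof cases
    case 1
    from less.prems(3) [OF this] show ?thesis by blast
  next
    case 2
    let ?G = "apply_pa (assign_lit x) G"
    from 2 less.prems(3) obtain C where C: "C \<in> F" "C - D \<subseteq> {x}" by blast
    show ?thesis
    proof (cases "x \<in> C \<and> x \<notin> D")
      case True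
      with C assms(1) have x: "compl x \<in> D"
        by (auto simp: up_closed_def)
      have "lvar x \<in> vars G"
        using 2 by (force simp: vars_def)
      then have "vars ?G \<subset> vars G"
        using vars_apply_assign_lit [of x G] by blast
      then have "card (vars ?G) < card (vars G)" "finite (vars ?G)"
        using less.prems(1) by (auto intro: psubset_card_mono finite_subset)
      moreover have "r1 ?G = {{}}"
        using r1_unit [of G x] 2 less.prems by simp
      moreover have "\<exists>C\<in>F. C - D \<subseteq> B" if "B \<in> ?G" for B
      proof -
        obtain B' where "B' \<in> G" "B = B' - {compl x}"
          using \<open>B \<in> ?G\<close> by (auto simp: apply_assign_lit)
        with less.prems(3) x show ?thesis by blast
      qed
      ultimately show ?thesis
        using less.hyps by blast
    qed (use C in blast)
  next
    case 3
    then show ?thesis using less.prems(2) r1_no_unit [of G] by auto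
  qed
qed

text \<open>The witness consists of the complements of the literals that propagation makes true. It
  is consistent because each step removes a variable. When propagation stops, no clause is empty or
  unit, so nothing more is forced.\<close>

lemma up_closed_if_r1_not_bot:
  assumes "finite (vars G)" "r1 G \<noteq> {{}}"
  shows "\<exists>D. lvar ` D \<subseteq> vars G \<and> (\<forall>x\<in>D. compl x \<notin> D) \<and> up_closed G D \<and> (\<forall>C\<in>G. \<not> C \<subseteq> D)"
  using assms
proof (induction "card (vars G)" arbitrary: G rule: less_induct)
  case less
  have bot: "{} \<notin> G"
    using less.prems r1_bot by blast
  show ?case
  proof (cases "\<exists>x. {x} \<in> G")
    case True
    then obtain x where x: "{x} \<in> G" by blast
    let ?G = "apply_pa (assign_lit x) G"
    have lx: "lvar x \<in> vars G"
      using x by (force simp: vars_def)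
    then have "vars ?G \<subset> vars G"
      using vars_apply_assign_lit [of x G] by blast
    then have "card (vars ?G) < card (vars G)" "finite (vars ?G)"
      using less.prems(1) by (auto intro: psubset_card_mono finite_subset)
    moreover have "r1 ?G \<noteq> {{}}"
      using r1_unit [of G x] bot x less.prems by simp
    ultimately obtain D where D: "lvar ` D \<subseteq> vars ?G" "\<forall>y\<in>D. compl y \<notin> D"
        "up_closed ?G D" "\<forall>C\<in>?G. \<not> C \<subseteq> D"
      using less.hyps [of ?G] by metis
    have "lvar x \<notin> lvar ` D"
      using D(1) vars_apply_assign_lit [of x G] by blast
    then have xD: "x \<notin> D" "compl x \<notin> D"
      by (metis imageI lvar_compl)+
    let ?D = "insert (compl x) D"
    have "lvar ` ?D \<subseteq> vars G"
      using D(1) vars_apply_assign_lit [of x G] lx by auto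
    moreover have "\<forall>y\<in>?D. compl y \<notin> ?D"
    proof
      fix y assume "y \<in> ?D"
      with D(2) xD show "compl y \<notin> ?D"
        by (cases "y = compl x") (auto dest: arg_cong [of _ _ compl])
    qed
    moreover have "compl y \<in> ?D" if C: "C \<in> G" "y \<in> C" "C - {y} \<subseteq> ?D" for C y
    proof (cases "x \<in> C")
      case True
      with C xD show ?thesis by auto
    next
      case False
      then have "C - {compl x} \<in> ?G"
        using C by (auto simp: apply_assign_lit)
      then have *: "\<not> C - {compl x} \<subseteq> D" "\<And>y. y \<in> C - {compl x} \<Longrightarrow> C - {compl x} - {y} \<subseteq> D \<Longrightarrow> compl y \<in> D"
        using D(3,4) by (auto simp: up_closed_def)
      \<comment> \<open>Otherwise \<open>C - {y}\<close> would be a clause of \<open>?G\<close>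
        contained in \<open>D\<close>.\<close>
      have "y \<noteq> compl x"
        using *(1) C by auto
      with C * show ?thesis by blast
    qed
    moreover have "\<not> C \<subseteq> ?D" if C: "C \<in> G" for C
    proof (cases "x \<in> C")
      case True
      with xD show ?thesis by auto
    next
      case False
      then have "C - {compl x} \<in> ?G"
        using C by (auto simp: apply_assign_lit)
      with D(4) show ?thesis by blast
    qed
    ultimately show ?thesis
      unfolding up_closed_def by (intro exI [of _ ?D] conjI) (assumption | intro ballI impI)+
  next
    case False
    have "\<not> C - {y} \<subseteq> {}" if "C \<in> G" "y \<in> C" for C y
      using that False by (metis Diff_eq_empty_iff insert_absorb singleton_insert_inj_eq' subset_empty subset_singletonD)
    then have "up_closed G {}" "\<forall>C\<in>G. \<not> C \<subseteq> {}"
      using bot by (auto simp: up_closed_def)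
    then show ?thesis by (intro exI [of _ "{}"]) auto
  qed
qed

lemma r1_apply_pa_bot_iff:
  assumes "finite (vars F)"
  shows "r1 (apply_pa \<phi> F) = {{}} \<longleftrightarrow>
    (\<forall>D. up_closed F D \<and> {x. falsifies_lit \<phi> x} \<subseteq> D \<longrightarrow> (\<exists>C\<in>F. C \<subseteq> D))" (is "_ \<longleftrightarrow> ?R")
proof -
  let ?G = "apply_pa \<phi> F"
  have dom: "\<phi> v = None" if "v \<in> vars ?G" for v
    using that by (cases "\<phi> v") (auto simp: vars_def apply_pa_def satisfies_lit_def falsifies_lit_def)
  have "vars ?G \<subseteq> vars F"
    by (auto simp: vars_def apply_pa_def)
  with assms have fin: "finite (vars ?G)"
    by (rule rev_finite_subset)
  show ?thesis
  proof
    assume r1: "r1 ?G = {{}}"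
    show ?R
    proof (intro allI impI, elim conjE)
      fix D assume D: "up_closed F D" "{x. falsifies_lit \<phi> x} \<subseteq> D"
      have "\<exists>C\<in>F. C - D \<subseteq> B" if "B \<in> ?G" for B
        using that D(2) by (auto simp: apply_pa_def)
      then show "\<exists>C\<in>F. C \<subseteq> D"
        using conflict_if_r1_bot [OF D(1) fin r1] by blast
    qed
  next
    assume R: ?R
    show "r1 ?G = {{}}"
    proof (rule ccontr)
      assume "r1 ?G \<noteq> {{}}"
      then obtain D where D: "lvar ` D \<subseteq> vars ?G" "\<forall>x\<in>D. compl x \<notin> D"
          "up_closed ?G D" "\<forall>C\<in>?G. \<not> C \<subseteq> D"
        using up_closed_if_r1_not_bot [OF fin] by blast
      let ?D = "D \<union> {x. falsifies_lit \<phi> x}"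
      \<comment> \<open>A clause satisfied by \<open>\<phi>\<close> contains a literal
        \<open>x\<close> outside \<open>?D\<close> with \<open>compl x \<in> ?D\<close>. Hence it is
        no conflict, and the only literal it could force is \<open>x\<close>, whose complement is
        present already.\<close>
      have sat: "x \<notin> ?D" "compl x \<in> ?D" if "satisfies_lit \<phi> x" for x
        using that D(1) dom by (force simp: satisfies_lit_def falsifies_lit_def)+
      have ncon: "\<not> C \<subseteq> ?D" and cl: "y \<in> C \<Longrightarrow> C - {y} \<subseteq> ?D \<Longrightarrow> compl y \<in> ?D"
        if C: "C \<in> F" for C y
      proof -
        have "\<not> C \<subseteq> ?D \<and> (y \<in> C \<longrightarrow> C - {y} \<subseteq> ?D \<longrightarrow> compl y \<in> ?D)"
        proof (cases "\<exists>x\<in>C. satisfies_lit \<phi> x")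
          case True
          with sat show ?thesis by blast
        next
          case False
          let ?C = "{x \<in> C. \<not> falsifies_lit \<phi> x}"
          have "?C \<in> ?G"
            using C False by (auto simp: apply_pa_def)
          then have *: "\<not> ?C \<subseteq> D" "\<And>y. y \<in> ?C \<Longrightarrow> ?C - {y} \<subseteq> D \<Longrightarrow> compl y \<in> D"
            using D(3,4) by (auto simp: up_closed_def)
          have "compl y \<in> D" if "y \<in> C" "C - {y} \<subseteq> ?D"
            using *(1) *(2) [of y] that by blast
          with *(1) show ?thesis by blast
        qed
        then show "\<not> C \<subseteq> ?D" "y \<in> C \<Longrightarrow> C - {y} \<subseteq> ?D \<Longrightarrow> compl y \<in> ?D" by blast+
      qed
      have "up_closed F ?D"
        unfolding up_closed_def using cl by blast
      with R ncon show False by blast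
    qed
  qed
qed

text \<open>Soundness of propagation: if all literals of a satisfied clause except \<open>y\<close>
  are false, then \<open>y\<close> is true. Both translations use this set as an upper bound on what
  propagation can falsify.\<close>

lemma up_closed_false_lits:
  assumes "models \<tau> F"
  shows "up_closed F {x. \<tau> (lvar x) \<noteq> lsign x}" "\<And>C. C \<in> F \<Longrightarrow> \<not> C \<subseteq> {x. \<tau> (lvar x) \<noteq> lsign x}"
  using assms by (fastforce simp: up_closed_def models_def)+


section \<open>Gate lists\<close>

text \<open>The part of \<open>is_mcircuit\<close> that makes sense before an output is chosen, so
  that gate lists can be extended step by step.\<close>

definition wf_gates :: "'i set \<Rightarrow> 'i gate list \<Rightarrow> bool" where
  "wf_gates I gs \<longleftrightarrow> (\<forall>k < length gs. preds (gs ! k) \<subseteq> Input ` I \<union> Gate ` {..<k})"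

definition gates_size :: "'i gate list \<Rightarrow> nat" where
  "gates_size gs = length gs + (\<Sum>g\<leftarrow>gs. card (preds g))"

lemma gate_vals_Nil [simp]: "gate_vals \<alpha> [] = []"
  by (simp add: gate_vals_def)

lemma gate_vals_snoc: "gate_vals \<alpha> (gs @ [g]) = gate_vals \<alpha> gs @ [gate_val \<alpha> (gate_vals \<alpha> gs) g]"
  by (simp add: gate_vals_def)

lemma length_gate_vals [simp]: "length (gate_vals \<alpha> gs) = length gs"
  by (induction gs rule: rev_induct) (auto simp: gate_vals_snoc)

lemma node_val_append:
  assumes "p \<in> Input ` I \<union> Gate ` {..<length bs}"
  shows "node_val \<alpha> (bs @ cs) p = node_val \<alpha> bs p"
  using assms by (auto simp: nth_append)

lemma gate_val_append:
  assumes "preds g \<subseteq> Input ` I \<union> Gate ` {..<length bs}"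
  shows "gate_val \<alpha> (bs @ cs) g = gate_val \<alpha> bs g"
proof -
  have "node_val \<alpha> (bs @ cs) p = node_val \<alpha> bs p" if "p \<in> preds g" for p
    by (rule node_val_append [OF subsetD [OF assms that]])
  then show ?thesis by (cases g) auto
qed

lemma wf_gates_snoc:
  "wf_gates I (gs @ [g]) \<longleftrightarrow> wf_gates I gs \<and> preds g \<subseteq> Input ` I \<union> Gate ` {..<length gs}"
  unfolding wf_gates_def length_append_singleton All_less_Suc by (auto simp: nth_append)

text \<open>Gate \<open>k\<close> is evaluated on the prefix before it, and appending later values
  changes nothing it reads. So the final list of values satisfies the gate equations
  simultaneously.\<close>

lemma gate_vals_nth:
  assumes "wf_gates I gs" "k < length gs"
  shows "gate_vals \<alpha> gs ! k = gate_val \<alpha> (gate_vals \<alpha> gs) (gs ! k)"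
  using assms
proof (induction gs rule: rev_induct)
  case (snoc g gs)
  have *: "wf_gates I gs" "preds g \<subseteq> Input ` I \<union> Gate ` {..<length gs}"
    using snoc.prems(1) by (simp_all add: wf_gates_snoc)
  show ?case
  proof (cases "k = length gs")
    case True
    then show ?thesis
      using gate_val_append [of g I "gate_vals \<alpha> gs"] *(2) by (simp add: gate_vals_snoc nth_append)
  next
    case False
    then have k: "k < length gs" using snoc.prems by simp
    then have "preds (gs ! k) \<subseteq> Input ` I \<union> Gate ` {..<length gs}"
      using *(1) by (fastforce simp: wf_gates_def)
    then show ?thesis
      using gate_val_append [of "gs ! k" I "gate_vals \<alpha> gs"] snoc.IH [OF *(1) k] k
      by (simp add: gate_vals_snoc nth_append)
  qed
qed simp


section \<open>From circuits to clause-sets\<close>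

text \<open>The Tseitin translation, restricted to the implications from a gate to its predecessors.
  The input \<open>v\<^sup>0\<close> is \<open>0\<close> iff \<open>v\<close> is set to \<open>0\<close>, so it becomes the literal \<open>v\<close>; dually for \<open>v\<^sup>1\<close>.
  The injection \<open>e\<close> supplies the fresh variables: \<open>e (Suc k)\<close> stands for gate \<open>k\<close>.\<close>

primrec node_lit :: "(nat \<Rightarrow> 'v) \<Rightarrow> ('v \<times> bool) node \<Rightarrow> 'v lit" where
  "node_lit e (Input i) = (if snd i then Neg (fst i) else Pos (fst i))"
| "node_lit e (Gate k) = Pos (e (Suc k))"

primrec gate_clauses :: "(nat \<Rightarrow> 'v) \<Rightarrow> nat \<Rightarrow> ('v \<times> bool) gate \<Rightarrow> 'v clause set" where
  "gate_clauses e k (And P) = (\<lambda>p. {Neg (e (Suc k)), node_lit e p}) ` P"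
| "gate_clauses e k (Or P) = {insert (Neg (e (Suc k))) (node_lit e ` P)}"

text \<open>The last clause only makes all variables of \<open>V\<close> occur. The filter drops the tautological
  clauses of those disjunctions that read both \<open>v\<^sup>0\<close> and \<open>v\<^sup>1\<close>.\<close>

definition circuit_cnf :: "(nat \<Rightarrow> 'v) \<Rightarrow> 'v set \<Rightarrow> ('v \<times> bool) mcircuit \<Rightarrow> 'v clause set" where
  "circuit_cnf e V C = {B \<in> (\<Union>k<length (gates C). gate_clauses e k (gates C ! k)) \<union>
     {{node_lit e (out_node C)}, insert (Pos (e 0)) (Pos ` V)}. is_clause B}"

definition encode :: "'v set \<Rightarrow> 'v passign \<Rightarrow> ('v \<times> bool) passign" where
  "encode V \<phi> = (\<lambda>(v, b). if v \<in> V then Some (\<phi> v \<noteq> Some b) else None)"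

lemma dom_encode: "dom (encode V \<phi>) = V \<times> UNIV"
  by (auto simp: encode_def split: if_splits)

text \<open>If \<open>F\<close> represents \<open>f\<close> and \<open>\<phi>\<close> assigns only
  variables of \<open>f\<close>, the right-hand side is satisfiability of \<open>\<phi> * F\<close>.
  This links the values of the monotonisation to the condition on hardness.\<close>

lemma monotonisation_encode:
  "bf_val (monotonisation f) (encode (bf_vars f) \<phi>) \<longleftrightarrow>
    (\<exists>\<psi>. dom \<psi> = bf_vars f \<and> bf_val f \<psi> \<and> (\<forall>v\<in>bf_vars f. \<phi> v \<noteq> None \<longrightarrow> \<phi> v = \<psi> v))"
proof -
  have "encode (bf_vars f) \<phi> (v, \<not> the (\<psi> v)) = Some True \<longleftrightarrow> (\<phi> v \<noteq> None \<longrightarrow> \<phi> v = \<psi> v)"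
    if "dom \<psi> = bf_vars f" "v \<in> bf_vars f" for \<psi> v
    using that by (cases "\<phi> v"; cases "\<psi> v") (auto simp: encode_def)
  then show ?thesis
    unfolding monotonisation_def boolfun.sel by metis
qed

locale tseitin =
  fixes V :: "'v set" and C :: "('v \<times> bool) mcircuit" and e :: "nat \<Rightarrow> 'v"
  assumes fin: "finite V" and wf: "is_mcircuit C" and ins: "inputs C = V \<times> UNIV"
    and inj: "inj e" and fresh: "range e \<inter> V = {}"
begin

abbreviation "F \<equiv> circuit_cnf e V C"

lemma e_eq [simp]: "e i = e j \<longleftrightarrow> i = j"
  using inj by (simp add: inj_eq)

lemma e_notin [simp]: "e i \<notin> V"
  using fresh by auto

lemma wf_gates: "wf_gates (V \<times> UNIV) (gates C)"
  using wf by (simp add: is_mcircuit_def wf_gates_def ins)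

lemma preds_gate: "k < length (gates C) \<Longrightarrow> preds (gates C ! k) \<subseteq> Input ` (V \<times> UNIV) \<union> Gate ` {..<k}"
  using wf_gates by (simp add: wf_gates_def)

lemma finite_preds: "k < length (gates C) \<Longrightarrow> finite (preds (gates C ! k))"
  by (rule finite_subset [OF preds_gate]) (use fin in auto)

lemma out_node: "out_node C \<in> Input ` (V \<times> UNIV) \<union> Gate ` {..<length (gates C)}"
  using wf by (simp add: is_mcircuit_def ins)

lemma finite_gate_clauses: "k < length (gates C) \<Longrightarrow> finite (gate_clauses e k (gates C ! k))"
  using finite_preds [of k] by (cases "gates C ! k") auto

lemma is_clause_set_F: "is_clause_set F"
  using finite_gate_clauses by (auto simp: is_clause_set_def circuit_cnf_def)

lemma out_clause: "{node_lit e (out_node C)} \<in> F"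
  by (auto simp: circuit_cnf_def is_clause_def)

lemma dummy_clause: "insert (Pos (e 0)) (Pos ` V) \<in> F"
  using fin by (auto simp: circuit_cnf_def is_clause_def)

lemma vars_F: "V \<subseteq> vars F"
  using dummy_clause by (force simp: vars_def)

text \<open>Unit propagation evaluates the circuit under the encoding of \<open>\<phi>\<close>: it falsifies every node
  of value \<open>0\<close>.\<close>

lemma node_lit_falsified:
  assumes D: "up_closed F D" "{x. falsifies_lit \<phi> x} \<subseteq> D"
    and p: "p \<in> Input ` (V \<times> UNIV) \<union> Gate ` {..<length (gates C)}"
      "\<not> node_val (encode V \<phi>) (gate_vals (encode V \<phi>) (gates C)) p"
  shows "node_lit e p \<in> D"
proof -
  let ?\<alpha> = "encode V \<phi>"
  let ?val = "node_val ?\<alpha> (gate_vals ?\<alpha> (gates C))"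
  have input: "node_lit e (Input i) \<in> D" if "i \<in> V \<times> UNIV" "\<not> ?val (Input i)" for i
  proof -
    have "\<phi> (fst i) = Some (snd i)"
      using that by (auto simp: encode_def)
    then show ?thesis
      using D(2) by (auto simp: falsifies_lit_def split: if_splits)
  qed
  have gate: "Pos (e (Suc k)) \<in> D" if "k < length (gates C)" "\<not> ?val (Gate k)" for k
    using that
  proof (induction k rule: less_induct)
    case (less k)
    have ps: "node_lit e p \<in> D" if "p \<in> preds (gates C ! k)" "\<not> ?val p" for p
      using preds_gate [OF less.prems(1)] that input less by force
    \<comment> \<open>Predecessors are inputs over \<open>V\<close> or earlier gates, so freshness
      and injectivity of \<open>e\<close> keep their literals from clashing with
      \<open>Neg (e (Suc k))\<close>. The filter can then keep the clause.\<close>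
    have ncl: "Pos (e (Suc k)) \<noteq> node_lit e p" if "p \<in> preds (gates C ! k)" for p
      using subsetD [OF preds_gate [OF less.prems(1)] that] by (auto split: if_splits)
    have mem: "B \<in> F" if "B \<in> gate_clauses e k (gates C ! k)" "is_clause B" for B
      using less.prems that by (auto simp: circuit_cnf_def)
    have val: "\<not> gate_val ?\<alpha> (gate_vals ?\<alpha> (gates C)) (gates C ! k)"
      using less.prems gate_vals_nth [OF wf_gates] by simp
    show ?case
    proof (cases "gates C ! k")
      case (And P)
      then obtain p where p: "p \<in> P" "\<not> ?val p"
        using val by auto
      let ?B = "{Neg (e (Suc k)), node_lit e p}"
      have "is_clause ?B"
        using ncl p And by (auto simp: is_clause_def lit_eq_iff)
      then have "?B \<in> F"
        using mem p And by simp
      moreover have "?B - {Neg (e (Suc k))} \<subseteq> D"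
        using ps p And by auto
      ultimately have "compl (Neg (e (Suc k))) \<in> D"
        using D(1) unfolding up_closed_def by blast
      then show ?thesis by simp
    next
      case (Or P)
      then have PD: "node_lit e ` P \<subseteq> D"
        using val ps by auto
      let ?B = "insert (Neg (e (Suc k))) (node_lit e ` P)"
      \<comment> \<open>Complementary literals could only come from \<open>v\<^sup>0\<close> and
        \<open>v\<^sup>1\<close>, which are never both 0 under an encoding. So a disjunction whose
        clause was filtered out has value 1, and no falsification has to pass through it.\<close>
      have "compl (node_lit e p) \<noteq> node_lit e q" if pq: "p \<in> P" "q \<in> P" for p q
      proof
        assume eq: "compl (node_lit e p) = node_lit e q"
        have "p \<in> Input ` (V \<times> UNIV) \<union> Gate ` {..<k}" "q \<in> Input ` (V \<times> UNIV) \<union> Gate ` {..<k}"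
          using preds_gate [OF less.prems(1)] pq Or by auto
        with eq obtain v b where "p = Input (v, b)" "q = Input (v, \<not> b)" "v \<in> V"
          by (auto split: if_splits)
        moreover have "\<not> ?val p" "\<not> ?val q"
          using val pq Or by auto
        ultimately show False by (auto simp: encode_def)
      qed
      moreover have "compl (node_lit e p) \<noteq> Neg (e (Suc k))" if "p \<in> P" for p
        using ncl [of p] that Or by (auto simp: lit_eq_iff)
      ultimately have "is_clause ?B"
        using ncl Or finite_preds [OF less.prems(1)] by (auto simp: is_clause_def)
      then have "?B \<in> F"
        using mem Or by simp
      moreover have "?B - {Neg (e (Suc k))} \<subseteq> D"
        using PD by auto
      ultimately have "compl (Neg (e (Suc k))) \<in> D"
        using D(1) unfolding up_closed_def by blast
      then show ?thesis by simp
    qed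
  qed
  from p input gate show ?thesis by auto
qed

text \<open>Used for two choices of \<open>D\<close>: the literals false under a model show that the
  circuit accepts whenever \<open>\<phi> * F\<close> is satisfiable, and the set left by a
  propagation without conflict yields \<open>hd_le_1\<close>.\<close>

lemma circuit_val_encode:
  assumes "up_closed F D" "{x. falsifies_lit \<phi> x} \<subseteq> D" "\<And>B. B \<in> F \<Longrightarrow> \<not> B \<subseteq> D"
  shows "circuit_val C (encode V \<phi>)"
proof (rule ccontr)
  assume "\<not> circuit_val C (encode V \<phi>)"
  then have "node_lit e (out_node C) \<in> D"
    unfolding circuit_val_def by (intro node_lit_falsified [OF assms(1,2) out_node])
  with assms(3) [OF out_clause] show False by simp
qed

text \<open>Each gate variable takes the value of its gate. Totality of \<open>\<psi>\<close>
  matters: an unassigned \<open>v\<close> has both inputs equal to 1, but their literals are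
  complementary and cannot both be true.\<close>

lemma models_if_circuit_val:
  assumes "circuit_val C (encode V \<psi>)" "dom \<psi> = V"
  shows "\<exists>\<tau>. extends \<tau> \<psi> \<and> models \<tau> F"
proof -
  let ?\<alpha> = "encode V \<psi>"
  let ?bs = "gate_vals ?\<alpha> (gates C)"
  let ?val = "node_val ?\<alpha> ?bs"
  \<comment> \<open>The value at \<open>e 0\<close> is \<open>True\<close> in order to satisfy the
    clause that mentions all of \<open>V\<close>.\<close>
  define \<tau> where "\<tau> v = (case \<psi> v of Some b \<Rightarrow> b | None \<Rightarrow> (case inv e v of 0 \<Rightarrow> True | Suc k \<Rightarrow> ?bs ! k))" for v
  have \<psi>e: "\<psi> (e i) = None" for i
    using assms(2) e_notin by blast
  have \<tau>0: "\<tau> (e 0)" and \<tau>S: "\<tau> (e (Suc k)) = ?bs ! k" for k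
    using \<psi>e inj by (simp_all add: \<tau>_def)
  have lit: "\<tau> (lvar (node_lit e p)) = lsign (node_lit e p)"
    if "?val p" "p \<in> Input ` (V \<times> UNIV) \<union> Gate ` {..<length (gates C)}" for p
  proof (cases p)
    case (Input i)
    then have "fst i \<in> V"
      using that by auto
    then obtain b where "\<psi> (fst i) = Some b"
      using assms(2) by blast
    then show ?thesis
      using that Input by (auto simp: encode_def \<tau>_def)
  next
    case (Gate k)
    then show ?thesis using that \<tau>S by auto
  qed
  have "\<exists>x\<in>B. \<tau> (lvar x) = lsign x" if "B \<in> F" for B
  proof -
    from that consider k where "k < length (gates C)" "B \<in> gate_clauses e k (gates C ! k)"
      | "B = {node_lit e (out_node C)}" | "B = insert (Pos (e 0)) (Pos ` V)"
      by (auto simp: circuit_cnf_def)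
    then show ?thesis
    proof cases
      case 1
      have val: "?bs ! k = gate_val ?\<alpha> ?bs (gates C ! k)"
        by (rule gate_vals_nth [OF wf_gates 1(1)])
      have ps: "\<tau> (lvar (node_lit e p)) = lsign (node_lit e p)"
        if "?val p" "p \<in> preds (gates C ! k)" for p
        using subsetD [OF preds_gate [OF 1(1)] that(2)] 1(1) by (intro lit [OF that(1)]) auto
      show ?thesis
        using 1(2) val ps \<tau>S [of k] by (cases "gates C ! k"; cases "?bs ! k") auto
    next
      case 2
      then show ?thesis
        using lit [OF _ out_node] assms(1) by (simp add: circuit_val_def)
    next
      case 3
      then show ?thesis using \<tau>0 by simp
    qed
  qed
  then show ?thesis
    by (intro exI [of _ \<tau>]) (auto simp: models_def extends_def \<tau>_def)
qed

lemma ell_gate_clauses: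
  assumes "k < length (gates C)"
  shows "ell (gate_clauses e k (gates C ! k)) \<le> 1 + 2 * card (preds (gates C ! k))"
proof (cases "gates C ! k")
  case (And P)
  then have "finite P"
    using finite_preds [OF assms] by simp
  have "(\<Sum>B\<in>gate_clauses e k (And P). card B) \<le> (\<Sum>B\<in>gate_clauses e k (And P). 2)"
    by (intro sum_mono) (auto simp: card_insert_if)
  also have "\<dots> \<le> 2 * card P"
    using card_image_le [OF \<open>finite P\<close>] by simp
  finally show ?thesis using And by (simp add: ell_def)
next
  case (Or P)
  then have "finite P"
    using finite_preds [OF assms] by simp
  then have "card (insert (Neg (e (Suc k))) (node_lit e ` P)) \<le> Suc (card P)"
    using card_image_le [OF \<open>finite P\<close>, of "node_lit e"] by (simp add: card_insert_if)
  then show ?thesis using Or by (simp add: ell_def)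
qed

text \<open>The factor 2 comes from the binary clauses, one per edge into a conjunction. The
  additive 2 pays for the output clause and for \<open>Pos (e 0)\<close>.\<close>

lemma ell_F: "ell F \<le> 2 * (circuit_size C + 1)"
proof -
  let ?G = "\<lambda>k. gate_clauses e k (gates C ! k)" and ?n = "length (gates C)"
  let ?U = "\<Union>k<?n. ?G k" and ?E = "{{node_lit e (out_node C)}, insert (Pos (e 0)) (Pos ` V)}"
  have finU: "finite ?U"
    using finite_gate_clauses by auto
  have "ell F \<le> ell (?U \<union> ?E)"
    unfolding ell_def circuit_cnf_def using finU by (intro sum_mono2) auto
  also have "\<dots> \<le> ell ?U + ell ?E"
    using finU by (intro ell_Un_le) auto
  also have "ell ?U \<le> (\<Sum>k<?n. ell (?G k))"
    using finite_gate_clauses by (intro ell_UN_le) auto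
  also have "\<dots> \<le> (\<Sum>k<?n. 1 + 2 * card (preds (gates C ! k)))"
    by (intro sum_mono ell_gate_clauses) simp
  also have "\<dots> = ?n + 2 * (\<Sum>g\<leftarrow>gates C. card (preds g))"
    unfolding sum.distrib by (simp add: sum_distrib_left [symmetric] sum_list_sum_nth atLeast0LessThan)
  also have "ell ?E \<le> 1 + (1 + card V)"
    using card_image_le [OF fin, of Pos] fin by (auto simp: ell_def card_insert_if sum.insert_if)
  also have "card V \<le> card (inputs C)"
    by (simp add: ins card_cartesian_product)
  finally show ?thesis
    by (simp add: circuit_size_def)
qed

end

lemma cnf_of_circuit:
  fixes f :: "'v::infinite boolfun"
  assumes "is_boolfun f" "computes C (monotonisation f)"
  shows "\<exists>F. cnf_representation F f \<and> hd_le_1 (bf_vars f) F \<and> ell F \<le> 2 * (circuit_size C + 1)"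
proof -
  let ?V = "bf_vars f"
  have finV: "finite ?V"
    using assms(1) by (simp add: is_boolfun_def)
  then have "infinite (UNIV - ?V)"
    using infinite_UNIV by (rule Diff_infinite_finite)
  then obtain e :: "nat \<Rightarrow> 'v" where e: "inj e" "range e \<subseteq> UNIV - ?V"
    using infinite_countable_subset by blast
  have bfv: "bf_vars (monotonisation f) = ?V \<times> UNIV"
    by (simp add: monotonisation_def)
  interpret tseitin ?V C e
    using assms(2) finV e bfv by unfold_locales (auto simp: computes_def)
  have val: "circuit_val C (encode ?V \<phi>) \<longleftrightarrow>
      (\<exists>\<psi>. dom \<psi> = ?V \<and> bf_val f \<psi> \<and> (\<forall>v\<in>?V. \<phi> v \<noteq> None \<longrightarrow> \<phi> v = \<psi> v))" for \<phi>
    using assms(2) monotonisation_encode [of f \<phi>] bfv by (simp add: computes_def dom_encode)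
  have val_total: "circuit_val C (encode ?V \<phi>) \<longleftrightarrow> bf_val f \<phi>" if "dom \<phi> = ?V" for \<phi>
  proof -
    have "\<psi> = \<phi>" if "dom \<psi> = ?V" "\<forall>v\<in>?V. \<phi> v \<noteq> None \<longrightarrow> \<phi> v = \<psi> v" for \<psi>
    proof
      fix v
      show "\<psi> v = \<phi> v"
        using that \<open>dom \<phi> = ?V\<close> by (metis domIff)
    qed
    with that show ?thesis
      unfolding val by blast
  qed
  have finF: "finite (vars F)"
    by (rule finite_vars [OF is_clause_set_F])
  have "satisfiable (apply_pa \<phi> F) \<longleftrightarrow> bf_val f \<phi>" if dom: "dom \<phi> = ?V" for \<phi>
  proof
    assume "satisfiable (apply_pa \<phi> F)"
    then obtain \<tau> where \<tau>: "extends \<tau> \<phi>" "models \<tau> F"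
      using satisfiable_apply_pa_iff [OF finF] by blast
    have "{x. falsifies_lit \<phi> x} \<subseteq> {x. \<tau> (lvar x) \<noteq> lsign x}"
      using \<tau>(1) by (auto simp: extends_def falsifies_lit_def)
    then have "circuit_val C (encode ?V \<phi>)"
      by (intro circuit_val_encode) (use up_closed_false_lits [OF \<tau>(2)] in auto)
    then show "bf_val f \<phi>"
      using val_total dom by blast
  next
    assume "bf_val f \<phi>"
    then show "satisfiable (apply_pa \<phi> F)"
      using satisfiable_apply_pa_iff [OF finF] models_if_circuit_val val_total dom by blast
  qed
  then have "cnf_representation F f"
    using is_clause_set_F vars_F by (simp add: cnf_representation_def)
  \<comment> \<open>A propagation without conflict makes the circuit accept the encoding of
    \<open>\<phi>\<close>. The monotonisation then supplies a total \<open>\<psi>\<close> extending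
    \<open>\<phi>\<close> with value 1, and the model of \<open>F\<close> built from
    \<open>\<psi>\<close> also extends \<open>\<phi>\<close>, contradicting
    unsatisfiability.\<close>
  moreover have "r1 (apply_pa \<phi> F) = {{}}"
    if dom: "dom \<phi> \<subseteq> ?V" and unsat: "\<not> satisfiable (apply_pa \<phi> F)" for \<phi>
  proof (rule ccontr)
    assume "r1 (apply_pa \<phi> F) \<noteq> {{}}"
    then obtain D where "up_closed F D" "{x. falsifies_lit \<phi> x} \<subseteq> D" "\<And>B. B \<in> F \<Longrightarrow> \<not> B \<subseteq> D"
      using r1_apply_pa_bot_iff [OF finF, of \<phi>] by (metis (no_types, lifting))
    then have "circuit_val C (encode ?V \<phi>)"
      by (rule circuit_val_encode)
    then obtain \<psi> where \<psi>: "dom \<psi> = ?V" "bf_val f \<psi>" "\<forall>v\<in>?V. \<phi> v \<noteq> None \<longrightarrow> \<phi> v = \<psi> v"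
      unfolding val by (elim exE conjE)
    then obtain \<tau> where \<tau>: "extends \<tau> \<psi>" "models \<tau> F"
      using models_if_circuit_val val_total by blast
    have "extends \<tau> \<phi>"
      unfolding extends_def
    proof (intro allI impI)
      fix v b assume "\<phi> v = Some b"
      with dom \<psi>(3) have "\<psi> v = Some b"
        by (metis domI option.distinct(1) subsetD)
      with \<tau>(1) show "\<tau> v = b" by (simp add: extends_def)
    qed
    with \<tau>(2) unsat show False
      using satisfiable_apply_pa_iff [OF finF] by blast
  qed
  then have "hd_le_1 ?V F"
    by (simp add: hd_le_1_def)
  ultimately show ?thesis
    using ell_F by blast
qed


section \<open>From clause-sets to circuits\<close>

text \<open>One shared gate list serves the whole family \<open>H\<close>. A later round can
  therefore read the nodes of an earlier one without copying them, and the sizes of the rounds add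
  up. The bound \<open>s\<close> leaves out the inputs, which are counted once at the end.\<close>

definition realizable :: "'i set \<Rightarrow> nat \<Rightarrow> ('i passign \<Rightarrow> bool) set \<Rightarrow> bool" where
  "realizable I s H \<longleftrightarrow> (\<exists>gs. wf_gates I gs \<and> gates_size gs \<le> s \<and>
     (\<forall>h\<in>H. \<exists>p\<in>Input ` I \<union> Gate ` {..<length gs}. \<forall>\<alpha>. node_val \<alpha> (gate_vals \<alpha> gs) p = h \<alpha>))"

definition combine :: "bool \<Rightarrow> ('a \<Rightarrow> bool) set \<Rightarrow> 'a \<Rightarrow> bool" where
  "combine b P \<alpha> = (if b then \<forall>h\<in>P. h \<alpha> else \<exists>h\<in>P. h \<alpha>)"

lemma realizable_mono: "realizable I s H \<Longrightarrow> s \<le> s' \<Longrightarrow> H' \<subseteq> H \<Longrightarrow> realizable I s' H'"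
  unfolding realizable_def by (meson order_trans subsetD)

lemma realizable_inputs: "realizable I 0 ((\<lambda>i \<alpha>. \<alpha> i = Some True) ` I)"
  unfolding realizable_def
  by (rule exI [of _ "[]"]) (auto simp: wf_gates_def gates_size_def)

lemma realizable_insert:
  assumes "realizable I s H" "P \<subseteq> H" "finite P"
  shows "realizable I (s + (card P + 1)) (insert (combine b P) H)"
proof -
  obtain gs where gs: "wf_gates I gs" "gates_size gs \<le> s"
    "\<forall>h\<in>H. \<exists>p\<in>Input ` I \<union> Gate ` {..<length gs}. \<forall>\<alpha>. node_val \<alpha> (gate_vals \<alpha> gs) p = h \<alpha>"
    using assms(1) by (auto simp: realizable_def)
  obtain nd where nd: "\<And>h. h \<in> H \<Longrightarrow> nd h \<in> Input ` I \<union> Gate ` {..<length gs}"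
    "\<And>h \<alpha>. h \<in> H \<Longrightarrow> node_val \<alpha> (gate_vals \<alpha> gs) (nd h) = h \<alpha>"
    using gs(3) unfolding Bex_def by (metis (no_types, lifting))
  define g where "g = (if b then And (nd ` P) else Or (nd ` P))"
  have preds: "preds g = nd ` P"
    by (simp add: g_def)
  let ?gs = "gs @ [g]"
  have "wf_gates I ?gs"
    using gs(1) nd(1) assms(2) by (auto simp: wf_gates_snoc preds)
  moreover have "gates_size ?gs \<le> s + (card P + 1)"
    using gs(2) card_image_le [OF assms(3), of nd] by (simp add: gates_size_def preds)
  moreover have "node_val \<alpha> (gate_vals \<alpha> ?gs) (Gate (length gs)) = combine b P \<alpha>" for \<alpha>
  proof -
    have "gate_val \<alpha> (gate_vals \<alpha> gs) g = combine b P \<alpha>"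
      using nd(2) assms(2) by (auto simp: g_def combine_def)
    then show ?thesis
      by (simp add: gate_vals_snoc nth_append)
  qed
  moreover have "node_val \<alpha> (gate_vals \<alpha> ?gs) (nd h) = h \<alpha>" if "h \<in> H" for h \<alpha>
    using node_val_append [of "nd h" I "gate_vals \<alpha> gs"] nd that by (simp add: gate_vals_snoc)
  moreover have "nd h \<in> Input ` I \<union> Gate ` {..<length ?gs}" if "h \<in> H" for h
    using nd(1) [OF that] by auto
  moreover have "Gate (length gs) \<in> Input ` I \<union> Gate ` {..<length ?gs}"
    by simp
  ultimately show ?thesis
    unfolding realizable_def by (metis (no_types, lifting) insertE)
qed

lemma realizable_family:
  assumes "realizable I s H" "finite X" "card X \<le> N"
    and "\<And>x. x \<in> X \<Longrightarrow> P x \<subseteq> H \<and> finite (P x) \<and> card (P x) \<le> m"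
  shows "realizable I (s + N * (m + 1)) (H \<union> (\<lambda>x. combine b (P x)) ` X)"
proof -
  have "realizable I (s + card X * (m + 1)) (H \<union> (\<lambda>x. combine b (P x)) ` X)"
    using assms(2,4)
  proof (induction X rule: finite_induct)
    case empty
    then show ?case using assms(1) by simp
  next
    case (insert x X)
    let ?H = "H \<union> (\<lambda>x. combine b (P x)) ` X"
    have "realizable I (s + card X * (m + 1)) ?H"
      using insert by blast
    moreover have "P x \<subseteq> ?H" "finite (P x)" "card (P x) \<le> m"
      using insert.prems [of x] by auto
    ultimately have "realizable I (s + card X * (m + 1) + (card (P x) + 1)) (insert (combine b (P x)) ?H)"
      by (intro realizable_insert)
    then show ?case
      by (rule realizable_mono) (use insert \<open>card (P x) \<le> m\<close> in auto)
  qed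
  then show ?thesis
    by (rule realizable_mono) (use mult_le_mono1 [OF assms(3), of "m + 1"] in auto)
qed

section \<open>Rounds of unit propagation, and counts bounded by \<open>ell\<close>\<close>

definition lits :: "'v clause set \<Rightarrow> 'v lit set" where
  "lits F = Pos ` vars F \<union> Neg ` vars F"

lemma in_lits_iff: "x \<in> lits F \<longleftrightarrow> lvar x \<in> vars F"
  by (cases x) (auto simp: lits_def)

lemma clause_subset_lits: "C \<in> F \<Longrightarrow> C \<subseteq> lits F"
  unfolding vars_def in_lits_iff subset_iff by blast

text \<open>Clauses are never simplified and consistency is never checked, so each round is monotone
  in \<open>S\<close>, even when both literals of a variable become falsified.\<close>

primrec up_iter :: "'v clause set \<Rightarrow> 'v lit set \<Rightarrow> nat \<Rightarrow> 'v lit set" where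
  "up_iter F S 0 = S"
| "up_iter F S (Suc t) =
     up_iter F S t \<union> {x. \<exists>C\<in>F. compl x \<in> C \<and> C - {compl x} \<subseteq> up_iter F S t}"

lemma up_iter_superset: "S \<subseteq> up_iter F S t"
  by (induction t) auto

lemma up_iter_least:
  assumes "up_closed F D" "S \<subseteq> D"
  shows "up_iter F S t \<subseteq> D"
proof (induction t)
  case (Suc t)
  have "x \<in> D" if "C \<in> F" "compl x \<in> C" "C - {compl x} \<subseteq> up_iter F S t" for C x
  proof -
    have "compl (compl x) \<in> D"
      using assms(1) that Suc unfolding up_closed_def by blast
    then show ?thesis by simp
  qed
  with Suc show ?case by auto
qed (use assms in simp)

text \<open>The rounds form an increasing chain inside the finite set \<open>lits F\<close> that is
  constant once a round adds nothing. Hence \<open>card (lits F)\<close> rounds suffice, a number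
  independent of \<open>S\<close>, as a fixed circuit requires.\<close>

lemma up_closed_up_iter:
  assumes "finite (vars F)" "S \<subseteq> lits F"
  shows "up_closed F (up_iter F S (card (lits F)))"
proof -
  let ?D = "up_iter F S"
  have fin: "finite (lits F)"
    using assms(1) by (simp add: lits_def)
  have sub: "?D t \<subseteq> lits F" for t
  proof (induction t)
    case (Suc t)
    have "x \<in> lits F" if "C \<in> F" "compl x \<in> C" for C x
      using clause_subset_lits [OF that(1)] that(2) by (auto simp: in_lits_iff)
    with Suc show ?case by auto
  qed (use assms in simp)
  have "mono ?D"
    by (intro incseq_SucI) auto
  then have "\<exists>N. (\<forall>n\<le>N. \<forall>m\<le>N. m < n \<longrightarrow> ?D m \<subset> ?D n) \<and> (\<forall>n\<ge>N. ?D N = ?D n)"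
    by (intro finite_mono_remains_stable_implies_strict_prefix)
      (use finite_subset [of "range ?D" "Pow (lits F)"] sub fin in auto)
  then have "?D (card (lits F)) = (\<Union>t. ?D t)"
    using finite_mono_strict_prefix_implies_finite_fixpoint [of ?D "lits F"] sub fin by blast
  then have *: "?D (Suc (card (lits F))) \<subseteq> ?D (card (lits F))"
    by blast
  show ?thesis
    unfolding up_closed_def
  proof (intro ballI impI)
    fix C y assume "C \<in> F" "y \<in> C" "C - {y} \<subseteq> ?D (card (lits F))"
    then have "compl y \<in> ?D (Suc (card (lits F)))"
      by auto
    with * show "compl y \<in> ?D (card (lits F))" by blast
  qed
qed

lemma card_clause_le_ell: "finite F \<Longrightarrow> C \<in> F \<Longrightarrow> card C \<le> ell F"
  unfolding ell_def by (intro member_le_sum) auto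

lemma card_vars_le_ell:
  assumes "is_clause_set F"
  shows "card (vars F) \<le> ell F"
proof -
  have "finite (\<Union>F)"
    using assms by (auto simp: is_clause_set_def is_clause_def)
  then have "card (vars F) \<le> card (\<Union>F)"
    unfolding vars_def by (rule card_image_le)
  also have "\<dots> \<le> ell F"
    unfolding ell_def by (rule card_Union_le_sum_card)
  finally show ?thesis .
qed

lemma card_lits_le_ell: "is_clause_set F \<Longrightarrow> card (lits F) \<le> 2 * ell F"
  using card_vars_le_ell [of F] card_Un_le [of "Pos ` vars F" "Neg ` vars F"]
    card_image_le [OF finite_vars, of F Pos] card_image_le [OF finite_vars, of F Neg]
  by (simp add: lits_def)

text \<open>The empty clause contributes nothing to \<open>ell\<close>, hence the
  \<open>+ 1\<close>.\<close>

lemma card_le_ell: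
  assumes "is_clause_set F"
  shows "card F \<le> ell F + 1"
proof -
  have fin: "finite F" "\<And>C. C \<in> F \<Longrightarrow> finite C"
    using assms by (auto simp: is_clause_set_def is_clause_def)
  have "card (F - {{}}) = (\<Sum>C\<in>F - {{}}. 1)"
    by simp
  also have "\<dots> \<le> (\<Sum>C\<in>F - {{}}. card C)"
    using fin by (intro sum_mono) (auto simp: Suc_le_eq card_gt_0_iff)
  also have "\<dots> \<le> ell F"
    unfolding ell_def using fin by (intro sum_mono2) auto
  finally show ?thesis
    using card_Suc_Diff1 [of F "{}"] fin by (cases "{} \<in> F") auto
qed

section \<open>The circuit that simulates the rounds\<close>

definition init_false :: "'v set \<Rightarrow> ('v \<times> bool) passign \<Rightarrow> 'v lit set" where
  "init_false V \<alpha> = {x. lvar x \<in> V \<and> \<alpha> (lvar x, \<not> lsign x) \<noteq> Some True}"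

text \<open>Switching inputs on shrinks the set of falsified literals. So the complement of that set
  is what is monotone in the inputs, and the circuit tracks it.\<close>

definition alive :: "'v clause set \<Rightarrow> 'v set \<Rightarrow> nat \<Rightarrow> 'v lit \<Rightarrow> ('v \<times> bool) passign \<Rightarrow> bool" where
  "alive F V t x \<alpha> \<longleftrightarrow> x \<notin> up_iter F (init_false V \<alpha>) t"

text \<open>Literals over \<open>V\<close> are inputs. All others are alive at the start, so the
  single gate \<open>And {}\<close> serves them.\<close>

lemma realizable_alive_0:
  "realizable (V \<times> UNIV) 1 (alive F V 0 ` lits F)"
proof -
  let ?I = "(\<lambda>i \<alpha>. \<alpha> i = Some True) ` (V \<times> UNIV)"
  have 1: "realizable (V \<times> UNIV) 1 (insert (combine True {}) ?I)"
    using realizable_insert [OF realizable_inputs, of "{}" "V \<times> UNIV" True] by simp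
  have sub: "alive F V 0 x \<in> insert (combine True {}) ?I" for x
  proof (cases "lvar x \<in> V")
    case True
    then have "alive F V 0 x = (\<lambda>\<alpha>. \<alpha> (lvar x, \<not> lsign x) = Some True)"
      by (auto simp: alive_def init_false_def fun_eq_iff)
    with True show ?thesis by auto
  next
    case False
    then have "alive F V 0 x = combine True {}"
      by (auto simp: alive_def init_false_def combine_def fun_eq_iff)
    then show ?thesis by simp
  qed
  show ?thesis
    by (rule realizable_mono [OF 1 le_refl image_subsetI [OF sub]])
qed

text \<open>A literal \<open>x\<close> stays alive iff it was alive and every clause containing
  \<open>compl x\<close> has another alive literal. This takes two layers: one disjunction per
  literal occurrence \<open>(C, y)\<close>, of which there are \<open>ell F\<close>, then one
  conjunction per literal. The cost is
  \<open>a * (a + 1) + 2 * a * (a + 2) = 3 * a\<^sup>2 + 5 * a\<close>, and \<open>a \<ge> 1\<close>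
  turns it into \<open>8 * a\<^sup>2\<close>.\<close>

lemma realizable_alive_Suc:
  assumes F: "is_clause_set F" and a: "a = ell F + 1"
    and IH: "realizable I s (alive F V t ` lits F)"
  shows "realizable I (s + 8 * a\<^sup>2) (alive F V (Suc t) ` lits F)"
proof -
  have fin: "finite F" "\<And>C. C \<in> F \<Longrightarrow> finite C"
    using F by (auto simp: is_clause_set_def is_clause_def)
  have finL: "finite (lits F)"
    using finite_vars [OF F] by (simp add: lits_def)
  define others where "others = (\<lambda>(C, y). combine False (alive F V t ` (C - {y})))"
  let ?H = "alive F V t ` lits F" and ?X = "Sigma F (\<lambda>C. C)"
  have card_others: "finite (C - {y}) \<and> card (alive F V t ` (C - {y})) \<le> a" if "C \<in> F" for C y
  proof -
    have "card (alive F V t ` (C - {y})) \<le> card (C - {y})"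
      using fin(2) [OF that] by (intro card_image_le) auto
    also have "\<dots> \<le> card C"
      using fin(2) [OF that] by (intro card_mono) auto
    also have "\<dots> \<le> a"
      using card_clause_le_ell [OF fin(1) that] a by simp
    finally show ?thesis
      using fin(2) [OF that] by simp
  qed
  have sub: "alive F V t ` (C - {y}) \<subseteq> ?H" if "C \<in> F" for C y
    using clause_subset_lits [OF that] by auto
  have "card ?X \<le> a"
    using fin a by (simp add: card_SigmaI ell_def)
  then have "realizable I (s + a * (a + 1))
      (?H \<union> (\<lambda>z. combine False (case z of (C, y) \<Rightarrow> alive F V t ` (C - {y}))) ` ?X)"
  proof (rule realizable_family [OF IH, rotated])
    show "(case z of (C, y) \<Rightarrow> alive F V t ` (C - {y})) \<subseteq> ?H \<and>
        finite (case z of (C, y) \<Rightarrow> alive F V t ` (C - {y})) \<and>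
        card (case z of (C, y) \<Rightarrow> alive F V t ` (C - {y})) \<le> a" if "z \<in> ?X" for z
    proof -
      obtain C y where "z = (C, y)" "C \<in> F"
        using \<open>z \<in> ?X\<close> by auto
      with sub [of C y] card_others [of C y] show ?thesis by simp
    qed
  qed (use fin in auto)
  then have 1: "realizable I (s + a * (a + 1)) (?H \<union> others ` ?X)"
    by (simp add: others_def case_prod_unfold)
  let ?P = "\<lambda>x. insert (alive F V t x) ((\<lambda>C. others (C, compl x)) ` {C \<in> F. compl x \<in> C})"
  have "card (?P x) \<le> a + 1" for x
  proof -
    have "card ((\<lambda>C. others (C, compl x)) ` {C \<in> F. compl x \<in> C}) \<le> card {C \<in> F. compl x \<in> C}"
      using fin(1) by (intro card_image_le) auto
    also have "\<dots> \<le> card F"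
      using fin(1) by (intro card_mono) auto
    also have "\<dots> \<le> a"
      using card_le_ell [OF F] a by simp
    finally show ?thesis
      using fin(1) by (simp add: card_insert_if)
  qed
  moreover have "?P x \<subseteq> ?H \<union> others ` ?X" if "x \<in> lits F" for x
    using that by auto
  moreover have "card (lits F) \<le> 2 * a"
    using card_lits_le_ell [OF F] a by simp
  ultimately have 2: "realizable I (s + a * (a + 1) + 2 * a * (a + 1 + 1))
      (?H \<union> others ` ?X \<union> (\<lambda>x. combine True (?P x)) ` lits F)"
    using fin(1) finL by (intro realizable_family [OF 1]) auto
  have "combine True (?P x) = alive F V (Suc t) x" for x
  proof
    fix \<alpha>
    show "combine True (?P x) \<alpha> = alive F V (Suc t) x \<alpha>"
      by (auto simp: combine_def others_def alive_def)
  qed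
  then have sub: "alive F V (Suc t) ` lits F \<subseteq> ?H \<union> others ` ?X \<union> (\<lambda>x. combine True (?P x)) ` lits F"
    by auto
  have "a \<le> a\<^sup>2"
    using a by (simp add: power2_eq_square)
  then have "s + a * (a + 1) + 2 * a * (a + 1 + 1) \<le> s + 8 * a\<^sup>2"
    by (simp add: power2_eq_square algebra_simps)
  from realizable_mono [OF 2 this sub] show ?thesis .
qed

lemma circuit_of_cnf:
  assumes f: "is_boolfun f" and rep: "cnf_representation F f" and hd: "hd_le_1 (bf_vars f) F"
  shows "\<exists>C. computes C (monotonisation f) \<and> circuit_size C \<le> 26 * (ell F + 1) ^ 3"
proof -
  let ?V = "bf_vars f"
  define a where "a = ell F + 1"
  define T where "T = card (lits F)"
  have F: "is_clause_set F" and V: "?V \<subseteq> vars F"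
    using rep by (auto simp: cnf_representation_def)
  have fin: "finite F" "\<And>C. C \<in> F \<Longrightarrow> finite C" "finite ?V" "finite (vars F)"
    using F f finite_vars [OF F] by (auto simp: is_clause_set_def is_clause_def is_boolfun_def)
  have cardV: "card ?V \<le> ell F"
    using card_mono [OF fin(4) V] card_vars_le_ell [OF F] by simp
  let ?I = "?V \<times> (UNIV :: bool set)"
  have iter: "realizable ?I (1 + t * (8 * a\<^sup>2)) (alive F ?V t ` lits F)" for t
  proof (induction t)
    case 0
    then show ?case using realizable_alive_0 by simp
  next
    case (Suc t)
    show ?case
      using realizable_alive_Suc [OF F a_def Suc] by (simp add: algebra_simps)
  qed
  \<comment> \<open>The output requires an alive literal in each member of \<open>X\<close>. The
    added pairs are not clauses; they reject inputs with
    \<open>v\<^sup>0 = v\<^sup>1 = 0\<close>.\<close>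
  define X where "X = F \<union> (\<lambda>v. {Pos v, Neg v}) ` ?V"
  have finX: "finite X"
    using fin by (simp add: X_def)
  have cardX: "card X \<le> 2 * a"
    using card_Un_le [of F "(\<lambda>v. {Pos v, Neg v}) ` ?V"] card_le_ell [OF F] cardV
      card_image_le [OF fin(3), of "\<lambda>v. {Pos v, Neg v}"] by (simp add: X_def a_def)
  have XB: "B \<subseteq> lits F \<and> finite B \<and> card B \<le> a" if "B \<in> X" for B
  proof (cases "B \<in> F")
    case True
    then show ?thesis
      using card_clause_le_ell [OF fin(1) True] fin(2) clause_subset_lits [OF True] by (auto simp: a_def)
  next
    case False
    then obtain v where v: "v \<in> ?V" "B = {Pos v, Neg v}"
      using \<open>B \<in> X\<close> by (auto simp: X_def)
    then have "card ?V > 0"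
      using fin(3) by (auto simp: card_gt_0_iff)
    with v V cardV show ?thesis
      by (auto simp: in_lits_iff a_def)
  qed
  have cardB: "card (alive F ?V T ` B) \<le> a" if "B \<in> X" for B
    using card_image_le [of B "alive F ?V T"] XB [OF that] by linarith
  let ?H = "alive F ?V T ` lits F" and ?o = "\<lambda>B. combine False (alive F ?V T ` B)"
  have "realizable ?I (1 + T * (8 * a\<^sup>2) + 2 * a * (a + 1)) (?H \<union> ?o ` X)"
    using XB cardB by (intro realizable_family [OF iter finX cardX]) auto
  then have "realizable ?I (1 + T * (8 * a\<^sup>2) + 2 * a * (a + 1) + (card (?o ` X) + 1))
      (insert (combine True (?o ` X)) (?H \<union> ?o ` X))"
    using finX by (intro realizable_insert) auto
  then obtain gs p where gs: "wf_gates ?I gs"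
      "gates_size gs \<le> 1 + T * (8 * a\<^sup>2) + 2 * a * (a + 1) + (card (?o ` X) + 1)"
      "p \<in> Input ` ?I \<union> Gate ` {..<length gs}"
      "\<And>\<alpha>. node_val \<alpha> (gate_vals \<alpha> gs) p = combine True (?o ` X) \<alpha>"
    unfolding realizable_def by (metis (no_types, lifting) insertI1)
  define C where "C = MCircuit ?I gs p"
  have "circuit_size C = gates_size gs + 2 * card ?V"
    by (simp add: circuit_size_def gates_size_def C_def card_cartesian_product)
  also have "\<dots> \<le> 2 + 16 * a ^ 3 + 2 * a * (a + 1) + 4 * a"
  proof -
    have "T * (8 * a\<^sup>2) \<le> (2 * a) * (8 * a\<^sup>2)"
      using card_lits_le_ell [OF F] by (intro mult_le_mono1) (simp add: T_def a_def)
    then have "T * (8 * a\<^sup>2) \<le> 16 * a ^ 3"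
      by (simp add: power2_eq_square power3_eq_cube)
    moreover have "card (?o ` X) \<le> 2 * a"
      using card_image_le [OF finX, of ?o] cardX by linarith
    ultimately show ?thesis
      using gs(2) cardV by (simp add: a_def)
  qed
  \<comment> \<open>Bounding every power of \<open>a\<close> by \<open>a ^ 3\<close> gives
    \<open>2 + 16 + (2 + 2) + 4 = 26\<close>.\<close>
  also have "\<dots> \<le> 26 * a ^ 3"
  proof -
    have "1 \<le> a" by (simp add: a_def)
    then have "1 \<le> a ^ 3" "a \<le> a ^ 3" "a ^ 2 \<le> a ^ 3"
      using power_increasing [of 1 3 a] power_increasing [of 2 3 a] by simp_all
    then show ?thesis
      by (simp add: power2_eq_square algebra_simps)
  qed
  finally have size: "circuit_size C \<le> 26 * (ell F + 1) ^ 3"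
    by (simp add: a_def)
  have val: "circuit_val C \<alpha> \<longleftrightarrow> bf_val (monotonisation f) \<alpha>" for \<alpha>
  proof -
    define D where "D = up_iter F (init_false ?V \<alpha>) T"
    have "init_false ?V \<alpha> \<subseteq> lits F"
      using V by (auto simp: init_false_def in_lits_iff)
    then have closed: "up_closed F D"
      unfolding D_def T_def by (intro up_closed_up_iter fin)
    have init: "init_false ?V \<alpha> \<subseteq> D"
      unfolding D_def by (rule up_iter_superset)
    have "circuit_val C \<alpha> \<longleftrightarrow> (\<forall>B\<in>X. \<not> B \<subseteq> D)"
      unfolding circuit_val_def C_def mcircuit.sel gs(4) by (auto simp: combine_def alive_def D_def)
    also have "\<dots> \<longleftrightarrow> (\<forall>B\<in>F. \<not> B \<subseteq> D) \<and> (\<forall>v\<in>?V. \<not> (Pos v \<in> D \<and> Neg v \<in> D))"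
      by (simp add: X_def ball_Un)
    also have "\<dots> \<longleftrightarrow> bf_val (monotonisation f) \<alpha>"
    proof
      assume ok: "(\<forall>B\<in>F. \<not> B \<subseteq> D) \<and> (\<forall>v\<in>?V. \<not> (Pos v \<in> D \<and> Neg v \<in> D))"
      \<comment> \<open>By \<open>ok\<close> at most one literal of each variable is falsified
        initially, so the order of the two tests is immaterial and \<open>\<phi>\<close> falsifies
        exactly the initial set.\<close>
      define \<phi> where "\<phi> v = (if v \<in> ?V \<and> Pos v \<in> init_false ?V \<alpha> then Some False
        else if v \<in> ?V \<and> Neg v \<in> init_false ?V \<alpha> then Some True else None)" for v
      have "x \<in> D" if "falsifies_lit \<phi> x" for x
        using that init by (cases x) (auto simp: falsifies_lit_def \<phi>_def split: if_splits)
      then have false: "{x. falsifies_lit \<phi> x} \<subseteq> D"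
        by auto
      have "r1 (apply_pa \<phi> F) \<noteq> {{}}"
      proof
        assume "r1 (apply_pa \<phi> F) = {{}}"
        then have "\<exists>B\<in>F. B \<subseteq> D"
          using r1_apply_pa_bot_iff [OF fin(4), of \<phi>] closed false by simp
        with ok show False by simp
      qed
      moreover have "dom \<phi> \<subseteq> ?V"
        by (auto simp: \<phi>_def split: if_splits)
      \<comment> \<open>Here hardness enters, by contraposition: since propagation finds no
        conflict, \<open>\<phi> * F\<close> is satisfiable.\<close>
      ultimately have "satisfiable (apply_pa \<phi> F)"
        using hd fin(3) finite_subset unfolding hd_le_1_def by blast
      then obtain \<tau> where \<tau>: "extends \<tau> \<phi>" "models \<tau> F"
        using satisfiable_apply_pa_iff [OF fin(4)] by blast
      define \<psi> where "\<psi> v = (if v \<in> ?V then Some (\<tau> v) else None)" for v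
      have dom: "dom \<psi> = ?V"
        by (auto simp: \<psi>_def split: if_splits)
      have "extends \<tau> \<psi>"
        by (auto simp: extends_def \<psi>_def split: if_splits)
      then have "satisfiable (apply_pa \<psi> F)"
        using satisfiable_apply_pa_iff [OF fin(4)] \<tau>(2) by blast
      then have "bf_val f \<psi>"
        using rep dom by (simp add: cnf_representation_def)
      moreover have "\<alpha> (v, \<not> the (\<psi> v)) = Some True" if v: "v \<in> ?V" for v
      proof (rule ccontr)
        assume *: "\<alpha> (v, \<not> the (\<psi> v)) \<noteq> Some True"
        show False
        proof (cases "\<tau> v")
          case True
          with * v have "Pos v \<in> init_false ?V \<alpha>"
            by (simp add: init_false_def \<psi>_def)
          then have "\<phi> v = Some False"
            using v by (simp add: \<phi>_def)
          with \<tau>(1) True show False by (auto simp: extends_def)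
        next
          case False
          with * v have "Neg v \<in> init_false ?V \<alpha>"
            by (simp add: init_false_def \<psi>_def)
          moreover from this have "Pos v \<notin> init_false ?V \<alpha>"
            using ok init v by blast
          ultimately have "\<phi> v = Some True"
            using v by (simp add: \<phi>_def)
          with \<tau>(1) False show False by (auto simp: extends_def)
        qed
      qed
      ultimately show "bf_val (monotonisation f) \<alpha>"
        using dom by (auto simp: monotonisation_def)
    next
      assume "bf_val (monotonisation f) \<alpha>"
      then obtain \<psi> where \<psi>: "dom \<psi> = ?V" "bf_val f \<psi>" "\<And>v. v \<in> ?V \<Longrightarrow> \<alpha> (v, \<not> the (\<psi> v)) = Some True"
        by (auto simp: monotonisation_def)
      then have "satisfiable (apply_pa \<psi> F)"
        using rep by (simp add: cnf_representation_def)
      then obtain \<tau> where \<tau>: "extends \<tau> \<psi>" "models \<tau> F"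
        using satisfiable_apply_pa_iff [OF fin(4)] by blast
      \<comment> \<open>The literals false under \<open>\<tau>\<close> are closed and contain the
        initial ones, hence all of \<open>D\<close>. They include no clause of \<open>F\<close> and
        no complementary pair, so no test of the output gate fails.\<close>
      let ?N = "{x. \<tau> (lvar x) \<noteq> lsign x}"
      have "init_false ?V \<alpha> \<subseteq> ?N"
      proof
        fix x assume "x \<in> init_false ?V \<alpha>"
        then have x: "lvar x \<in> ?V" "\<alpha> (lvar x, \<not> lsign x) \<noteq> Some True"
          by (auto simp: init_false_def)
        then obtain b where b: "\<psi> (lvar x) = Some b"
          using \<psi>(1) by blast
        then have "b \<noteq> lsign x"
          using \<psi>(3) [OF x(1)] x(2) by (metis option.sel)
        moreover have "\<tau> (lvar x) = b"
          using \<tau>(1) b by (simp add: extends_def)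
        ultimately show "x \<in> ?N" by simp
      qed
      then have DN: "D \<subseteq> ?N"
        unfolding D_def by (intro up_iter_least up_closed_false_lits \<tau>(2))
      show "(\<forall>B\<in>F. \<not> B \<subseteq> D) \<and> (\<forall>v\<in>?V. \<not> (Pos v \<in> D \<and> Neg v \<in> D))"
      proof (intro conjI ballI notI; (elim conjE)?)
        show False if "B \<in> F" "B \<subseteq> D" for B
          using up_closed_false_lits(2) [OF \<tau>(2) that(1)] order_trans [OF that(2) DN] by blast
        show False if "Pos v \<in> D" "Neg v \<in> D" for v
          using subsetD [OF DN that(1)] subsetD [OF DN that(2)] by simp
      qed
    qed
    finally show ?thesis .
  qed
  have "is_mcircuit C"
    using gs(1,3) fin(3) by (auto simp: is_mcircuit_def wf_gates_def C_def)
  then have "computes C (monotonisation f)"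
    using val by (simp add: computes_def C_def monotonisation_def)
  with size show ?thesis by blast
qed


section \<open>Polynomial bounds\<close>

text \<open>The summand 1 is absorbed because \<open>n ^ k \<ge> 1\<close> for
  \<open>n \<ge> 1\<close>; the exponent grows from \<open>k\<close> to \<open>k * m\<close>. The
  two directions use \<open>m = 3\<close> and \<open>m = 1\<close>.\<close>

lemma poly_bounded_trans:
  assumes s: "poly_bounded s" and t: "\<And>n. t n \<le> c * (s n + 1) ^ m"
  shows "poly_bounded t"
proof -
  obtain k where k: "(\<lambda>n. real (s n)) \<in> O(\<lambda>n. real n ^ k)"
    using s by (auto simp: poly_bounded_def)
  have "(\<lambda>n. 1 :: real) \<in> O(\<lambda>n. real n ^ k)"
    by (intro bigoI [of _ 1] eventually_mono [OF eventually_ge_at_top [of "1 :: nat"]]) auto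
  with k have "(\<lambda>n. real (s n) + 1) \<in> O(\<lambda>n. real n ^ k)"
    by (rule sum_in_bigo)
  then have "(\<lambda>n. (real (s n) + 1) ^ m) \<in> O(\<lambda>n. (real n ^ k) ^ m)"
    by (rule landau_o.big_power)
  then have "(\<lambda>n. real c * (real (s n) + 1) ^ m) \<in> O(\<lambda>n. real n ^ (k * m))"
    by (cases "c = 0") (simp_all add: power_mult)
  moreover have "(\<lambda>n. real (t n)) \<in> O(\<lambda>n. real c * (real (s n) + 1) ^ m)"
  proof (intro bigoI [of _ 1] always_eventually allI)
    fix n
    have "real (t n) \<le> real (c * (s n + 1) ^ m)"
      using t by (rule of_nat_mono)
    then show "norm (real (t n)) \<le> 1 * norm (real c * (real (s n) + 1) ^ m)"
      by (simp add: add.commute)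
  qed
  ultimately have "(\<lambda>n. real (t n)) \<in> O(\<lambda>n. real n ^ (k * m))"
    by (rule landau_o.big_trans [rotated])
  then show ?thesis
    by (auto simp: poly_bounded_def)
qed

theorem theorem6p5:
  fixes f :: "nat \<Rightarrow> 'v::infinite boolfun"
  assumes "\<And>n. is_boolfun (f n)"
  shows "(\<exists>F :: nat \<Rightarrow> 'v clause set.
            (\<forall>n. cnf_representation (F n) (f n) \<and> hd_le_1 (bf_vars (f n)) (F n)) \<and>
            poly_bounded (\<lambda>n. ell (F n)))
     \<longleftrightarrow> (\<exists>C :: nat \<Rightarrow> ('v \<times> bool) mcircuit.
            (\<forall>n. computes (C n) (monotonisation (f n))) \<and>
            poly_bounded (\<lambda>n. circuit_size (C n)))"
proof
  assume "\<exists>F :: nat \<Rightarrow> 'v clause set.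
            (\<forall>n. cnf_representation (F n) (f n) \<and> hd_le_1 (bf_vars (f n)) (F n)) \<and>
            poly_bounded (\<lambda>n. ell (F n))"
  then obtain F :: "nat \<Rightarrow> 'v clause set"
    where F: "\<And>n. cnf_representation (F n) (f n)" "\<And>n. hd_le_1 (bf_vars (f n)) (F n)"
      and pb: "poly_bounded (\<lambda>n. ell (F n))"
    by blast
  have "\<forall>n. \<exists>C. computes C (monotonisation (f n)) \<and> circuit_size C \<le> 26 * (ell (F n) + 1) ^ 3"
    using circuit_of_cnf assms F by blast
  then obtain C where C: "\<And>n. computes (C n) (monotonisation (f n))"
      "\<And>n. circuit_size (C n) \<le> 26 * (ell (F n) + 1) ^ 3"
    by metis
  with poly_bounded_trans [OF pb, OF C(2)]
  show "\<exists>C :: nat \<Rightarrow> ('v \<times> bool) mcircuit.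
            (\<forall>n. computes (C n) (monotonisation (f n))) \<and>
            poly_bounded (\<lambda>n. circuit_size (C n))"
    by blast
next
  assume "\<exists>C :: nat \<Rightarrow> ('v \<times> bool) mcircuit.
            (\<forall>n. computes (C n) (monotonisation (f n))) \<and>
            poly_bounded (\<lambda>n. circuit_size (C n))"
  then obtain C :: "nat \<Rightarrow> ('v \<times> bool) mcircuit"
    where C: "\<And>n. computes (C n) (monotonisation (f n))"
      and pb: "poly_bounded (\<lambda>n. circuit_size (C n))"
    by blast
  have "\<forall>n. \<exists>F. cnf_representation F (f n) \<and> hd_le_1 (bf_vars (f n)) F \<and>
      ell F \<le> 2 * (circuit_size (C n) + 1) ^ 1"
    using cnf_of_circuit assms C by (metis power_one_right)
  then obtain F where F: "\<And>n. cnf_representation (F n) (f n)" "\<And>n. hd_le_1 (bf_vars (f n)) (F n)"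
      "\<And>n. ell (F n) \<le> 2 * (circuit_size (C n) + 1) ^ 1"
    by metis
  with poly_bounded_trans [OF pb, OF F(3)]
  show "\<exists>F :: nat \<Rightarrow> 'v clause set.
            (\<forall>n. cnf_representation (F n) (f n) \<and> hd_le_1 (bf_vars (f n)) (F n)) \<and>
            poly_bounded (\<lambda>n. ell (F n))"
    by blast
qed

end
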